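(* Let $\alpha\in\mathbb{R}$ and let $m$ be a positive integer. Let $(s_j)_{j=0}^m$ and $(t_j)_{j=0}^m$ be sequences of Hermitian complex $q\times q$ matrices such that $t_j=s_j$ for all $j\in\{0,\dots,m-1\}$ and $t_m\le s_m$. Denote by $(s_j^{[1,\alpha]})_{j=0}^{m-1}$ and $(t_j^{[1,\alpha]})_{j=0}^{m-1}$ the first $\alpha$-S-transforms of $(s_j)_{j=0}^m$ and $(t_j)_{j=0}^m$, respectively. Then: (a) For each $j\in\{0,\dots,m-1\}$, the matrices $s_j^{[1,\alpha]}$ and $t_j^{[1,\alpha]}$ are both Hermitian. (b) $t_{m-1}^{[1,\alpha]}\le s_{m-1}^{[1,\alpha]}$. Furthermore, if $m\ge2$, then $t_j^{[1,\alpha]}=s_j^{[1,\alpha]}$ for all $j\in\{0,\dots,m-2\}$.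
   Context: $q$ is a positive integer; $A^\dagger$ is the Moore-Penrose inverse of a matrix $A$; for Hermitian matrices, $A\le B$ means that $B-A$ is non-negative Hermitian. First $\alpha$-S-transform of a sequence $(s_j)_{j=0}^m$ of complex $q\times q$ matrices: put $u_j=-\alpha s_{j-1}+s_j$ for $0\le j\le m$, with $s_{-1}=0$; let $u_0^\sharp=u_0^\dagger$ and $u_j^\sharp=-u_0^\dagger\sum_{l=0}^{j-1}u_{j-l}u_l^\sharp$ for $1\le j\le m$; then $s_j^{[1,\alpha]}=-s_0u_{j+1}^\sharp s_0$ for $0\le j\le m-1$. *)

theory Defs
  imports "HOL-Analysis.Analysis"
begin

definition conj_transpose :: "complex ^ 'n ^ 'm \<Rightarrow> complex ^ 'm ^ 'n" where
  "conj_transpose A = (\<chi> i j. cnj (A $ j $ i))"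

definition hermitian :: "complex ^ 'n ^ 'n \<Rightarrow> bool" where
  "hermitian A \<longleftrightarrow> conj_transpose A = A"

definition nonneg_hermitian :: "complex ^ 'n::finite ^ 'n \<Rightarrow> bool" where
  "nonneg_hermitian A \<longleftrightarrow>
     hermitian A \<and> (\<forall>x. (\<Sum>i\<in>UNIV. cnj (x $ i) * (A *v x) $ i) \<in> \<real>\<^sub>\<ge>\<^sub>0)"

definition loewner_le :: "complex ^ 'n::finite ^ 'n \<Rightarrow> complex ^ 'n ^ 'n \<Rightarrow> bool" where
  "loewner_le A B \<longleftrightarrow> nonneg_hermitian (B - A)"

definition is_moore_penrose_inverse ::
    "complex ^ 'n::finite ^ 'm::finite \<Rightarrow> complex ^ 'm ^ 'n \<Rightarrow> bool" where
  "is_moore_penrose_inverse A X \<longleftrightarrow>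
     A ** X ** A = A \<and> X ** A ** X = X \<and> hermitian (A ** X) \<and> hermitian (X ** A)"

definition moore_penrose_inverse ::
    "complex ^ 'n::finite ^ 'm::finite \<Rightarrow> complex ^ 'm ^ 'n" where
  "moore_penrose_inverse A = (THE X. is_moore_penrose_inverse A X)"

(* A finite sequence (s_j), 0 <= j <= m, is represented by a function on nat of which only the
   values at 0, ..., m matter: the term with index j of alpha_shift and of reciprocal_seq depends
   only on the entries with index at most j, and the term with index j of S_transform only on
   those with index at most j + 1.  So S_transform is meaningful for 0 <= j <= m - 1. *)

definition alpha_shift :: "real \<Rightarrow> (nat \<Rightarrow> complex ^ 'n ^ 'n) \<Rightarrow> nat \<Rightarrow> complex ^ 'n ^ 'n" where
  "alpha_shift \<alpha> s j = - \<alpha> *\<^sub>R (if j = 0 then 0 else s (j - 1)) + s j"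

fun reciprocal_seq ::
    "(nat \<Rightarrow> complex ^ 'n::finite ^ 'n) \<Rightarrow> nat \<Rightarrow> complex ^ 'n ^ 'n" where
  "reciprocal_seq u 0 = moore_penrose_inverse (u 0)"
| "reciprocal_seq u (Suc k) =
     - moore_penrose_inverse (u 0) ** (\<Sum>l = 0..k. u (Suc k - l) ** reciprocal_seq u l)"

definition S_transform ::
    "real \<Rightarrow> (nat \<Rightarrow> complex ^ 'n::finite ^ 'n) \<Rightarrow> nat \<Rightarrow> complex ^ 'n ^ 'n" where
  "S_transform \<alpha> s j = - (s 0 ** reciprocal_seq (alpha_shift \<alpha> s) (j + 1) ** s 0)"

end

theory Submission
  imports Defs
begin

text \<open>Let D be the Moore-Penrose inverse of the Hermitian matrix u(0); it is Hermitian. Unfolding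
the recursion for the reciprocal sequence r once from the left and once from the right writes r(k),
for k \<ge> 1, as D (E - u(k)) D, where E is the sum of the products u(a) r(i) u(b) over a + i + b = k
with a, b \<ge> 1. Reversing the factors permutes this sum, so E is Hermitian, which gives (a). Since
u(k) enters r(k) only through D u(k) D, changing the last entry from t(m) to s(m) changes the last
term of the S-transform by s(0) D (s(m) - t(m)) D s(0), which gives (b).\<close>

section \<open>Adjoints and Hermitian matrices\<close>

lemma conj_transpose_conj_transpose [simp]: "conj_transpose (conj_transpose A) = A"
  by (simp add: conj_transpose_def vec_eq_iff)

lemma conj_transpose_mult: "conj_transpose (A ** B) = conj_transpose B ** conj_transpose A"
  by (simp add: conj_transpose_def matrix_matrix_mult_def vec_eq_iff mult.commute)

text \<open>\<open>linear\<close> means real-linear here, as conjugation does not commute with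
  complex scalars; this suffices because \<alpha> is real.\<close>

lemma linear_conj_transpose: "linear conj_transpose"
  by (rule linearI) (simp_all add: conj_transpose_def vec_eq_iff)

lemmas conj_transpose_simps =
  linear_0[OF linear_conj_transpose] linear_add[OF linear_conj_transpose]
  linear_diff[OF linear_conj_transpose] linear_neg[OF linear_conj_transpose]
  linear_cmul[OF linear_conj_transpose] linear_sum[OF linear_conj_transpose]

lemma linear_matrix_mult_left: "linear (\<lambda>X :: complex ^ 'k ^ 'n. (A :: complex ^ 'n ^ 'm) ** X)"
  by (rule linearI)
    (simp_all add: matrix_matrix_mult_def vec_eq_iff ring_distribs sum.distrib scaleR_sum_right)

lemma linear_matrix_mult_right: "linear (\<lambda>X :: complex ^ 'n ^ 'm. X ** (B :: complex ^ 'k ^ 'n))"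
  by (rule linearI)
    (simp_all add: matrix_matrix_mult_def vec_eq_iff ring_distribs sum.distrib scaleR_sum_right)

lemmas matrix_mult_left_simps =
  linear_0[OF linear_matrix_mult_left] linear_add[OF linear_matrix_mult_left]
  linear_diff[OF linear_matrix_mult_left] linear_neg[OF linear_matrix_mult_left]
  linear_cmul[OF linear_matrix_mult_left] linear_sum[OF linear_matrix_mult_left]

lemmas matrix_mult_right_simps =
  linear_0[OF linear_matrix_mult_right] linear_add[OF linear_matrix_mult_right]
  linear_diff[OF linear_matrix_mult_right] linear_neg[OF linear_matrix_mult_right]
  linear_cmul[OF linear_matrix_mult_right] linear_sum[OF linear_matrix_mult_right]

lemma hermitian_conjugate:
  assumes "hermitian B"
  shows "hermitian (conj_transpose A ** B ** A)"
  using assms by (simp add: hermitian_def conj_transpose_mult matrix_mul_assoc)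

lemma hermitian_sandwich:
  assumes "hermitian A" "hermitian B"
  shows "hermitian (A ** B ** A)"
  using hermitian_conjugate[OF assms(2), of A] assms(1) by (simp add: hermitian_def)

text \<open>The diagonal entry of \<open>conj_transpose A ** A\<close> at \<open>j\<close> is the
  sum of the squared moduli of column \<open>j\<close> of \<open>A\<close>.\<close>

lemma conj_transpose_mult_self_eq_0:
  fixes A :: "complex ^ 'n::finite ^ 'm::finite"
  assumes "conj_transpose A ** A = 0"
  shows "A = 0"
proof -
  have "A $ i $ j = 0" for i j
  proof -
    have "(\<Sum>k\<in>UNIV. complex_of_real ((cmod (A $ k $ j))\<^sup>2)) = (conj_transpose A ** A) $ j $ j"
      unfolding complex_norm_square
      by (simp add: matrix_matrix_mult_def conj_transpose_def mult.commute)
    also have "\<dots> = 0" using assms by simp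
    finally have "(\<Sum>k\<in>UNIV. (cmod (A $ k $ j))\<^sup>2) = 0"
      by (metis of_real_eq_0_iff of_real_sum)
    then show ?thesis by (simp add: sum_nonneg_eq_0_iff)
  qed
  then show ?thesis by (simp add: vec_eq_iff)
qed

text \<open>As \<open>A\<close> is its own adjoint, the Gram matrix of \<open>A ** Y\<close> has
  \<open>A ** (A ** Y)\<close> as a right factor and so vanishes.\<close>

lemma hermitian_mult_cancel:
  fixes A :: "complex ^ 'n::finite ^ 'n" and Y :: "complex ^ 'k::finite ^ 'n"
  assumes "hermitian A" "A ** (A ** Y) = 0"
  shows "A ** Y = 0"
proof (rule conj_transpose_mult_self_eq_0)
  have "conj_transpose (A ** Y) ** (A ** Y) = conj_transpose Y ** (A ** (A ** Y))"
    using assms(1) by (simp add: conj_transpose_mult hermitian_def matrix_mul_assoc)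
  then show "conj_transpose (A ** Y) ** (A ** Y) = 0"
    by (simp add: assms(2) matrix_mult_left_simps)
qed

section \<open>The Moore-Penrose inverse of a Hermitian matrix\<close>

text \<open>\<open>A ** X\<close> and \<open>A ** Y\<close> are Hermitian projections with the same
  range, hence equal; \<open>X ** A\<close> and \<open>Y ** A\<close> are Hermitian projections with
  the same kernel. Then X = XAX = YAY = Y.\<close>

lemma moore_penrose_inverse_unique:
  assumes X: "is_moore_penrose_inverse A X" and Y: "is_moore_penrose_inverse A Y"
  shows "X = Y"
proof -
  note X' = X[unfolded is_moore_penrose_inverse_def] and Y' = Y[unfolded is_moore_penrose_inverse_def]
  have "A ** X = A ** Y ** (A ** X)" using Y' by (simp add: matrix_mul_assoc)
  also have "\<dots> = conj_transpose (A ** X ** (A ** Y))"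
    using X' Y' by (simp add: conj_transpose_mult hermitian_def)
  also have "\<dots> = A ** Y" using X' Y' by (simp add: matrix_mul_assoc hermitian_def)
  finally have AX: "A ** X = A ** Y" .
  have "X ** A = X ** A ** (Y ** A)" using Y' by (metis matrix_mul_assoc)
  also have "\<dots> = conj_transpose (Y ** A ** (X ** A))"
    using X' Y' by (simp add: conj_transpose_mult hermitian_def)
  also have "\<dots> = Y ** A" using X' Y' by (metis matrix_mul_assoc hermitian_def)
  finally have XA: "X ** A = Y ** A" .
  have "X = X ** (A ** X)" using X' by (simp add: matrix_mul_assoc)
  also have "\<dots> = Y ** A ** Y" by (simp add: AX XA matrix_mul_assoc)
  finally show ?thesis using Y' by simp
qed

text \<open>Multiplication by A is injective on the finite-dimensional real space A W, where W consists of
the Hermitian matrices commuting with A, and it maps A W into itself, so it maps A W onto A W, which contains A.\<close>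
lemma hermitian_inner_inverse_exists:
  fixes A :: "complex ^ 'n::finite ^ 'n"
  assumes A: "hermitian A"
  obtains Q where "hermitian Q" "A ** Q = Q ** A" "A ** Q ** A = A"
proof -
  define W where "W = {Q. hermitian Q \<and> A ** Q = Q ** A}"
  define S where "S = (\<lambda>Q. A ** Q) ` W"
  have "subspace W"
    by (rule subspaceI)
      (auto simp: W_def hermitian_def conj_transpose_simps matrix_mult_left_simps matrix_mult_right_simps)
  then have S: "subspace S"
    unfolding S_def by (rule linear_subspace_image[OF linear_matrix_mult_left])
  \<comment> \<open>A product of commuting Hermitian matrices is Hermitian, and \<open>A\<close>
    commutes with \<open>A ** Q\<close> if it commutes with \<open>Q\<close>.\<close>
  have S_sub_W: "S \<subseteq> W"
    using A by (auto simp: S_def W_def hermitian_def conj_transpose_mult) (metis matrix_mul_assoc)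
  then have sub: "(\<lambda>Q. A ** Q) ` S \<subseteq> S"
    by (auto simp: S_def)
  have "inj_on (\<lambda>Q. A ** Q) S"
  proof (rule inj_onI)
    fix X Y assume "X \<in> S" "Y \<in> S" and eq: "A ** X = A ** Y"
    then obtain X' Y' where *: "X = A ** X'" "Y = A ** Y'" by (auto simp: S_def)
    have "A ** (A ** (X' - Y')) = 0" using eq by (simp add: * matrix_mult_left_simps)
    then have "A ** (X' - Y') = 0" by (rule hermitian_mult_cancel[OF A])
    then show "X = Y" by (simp add: * matrix_mult_left_simps)
  qed
  then have "dim ((\<lambda>Q. A ** Q) ` S) = dim S"
    using S by (intro dim_image_eq[OF linear_matrix_mult_left]) (simp add: span_eq_iff[THEN iffD2])
  then have image: "(\<lambda>Q. A ** Q) ` S = S"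
    using S sub linear_subspace_image[OF linear_matrix_mult_left S]
    by (intro subspace_dim_equal) auto
  have "mat 1 \<in> W"
    by (simp add: W_def hermitian_def) (simp add: conj_transpose_def mat_def vec_eq_iff)
  then have "A \<in> S" by (force simp: S_def)
  \<comment> \<open>The preimage of \<open>A\<close> lies in \<open>S\<close>, so it is
    \<open>A ** Q\<close> with \<open>Q\<close> in \<open>W\<close>; commutation then moves one
    factor \<open>A\<close> to the right of \<open>Q\<close>.\<close>
  then obtain Q where "Q \<in> W" "A = A ** (A ** Q)" using image by (auto simp: S_def)
  then show ?thesis
    by (intro that[of Q]) (simp_all add: W_def, metis matrix_mul_assoc)
qed

text \<open>An explicit Hermitian matrix satisfies the four Penrose equations, and uniqueness
  identifies it with the \<open>THE\<close> term.\<close>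

lemma hermitian_moore_penrose_inverse:
  assumes A: "hermitian A"
  shows "hermitian (moore_penrose_inverse A)"
proof -
  obtain Q where Q: "hermitian Q" and comm: "A ** Q = Q ** A" and inner: "A ** Q ** A = A"
    by (rule hermitian_inner_inverse_exists[OF A])
  \<comment> \<open>An inner inverse \<open>Q\<close> may violate \<open>Q ** A ** Q = Q\<close>.
    Passing to \<open>X\<close> repairs this and leaves the products with \<open>A\<close>
    unchanged.\<close>
  define X where "X = Q ** A ** Q"
  have AX: "A ** X = A ** Q" and XA: "X ** A = A ** Q"
    unfolding X_def by (metis inner comm matrix_mul_assoc)+
  have "hermitian (A ** Q)"
    using A Q comm by (simp add: hermitian_def conj_transpose_mult)
  moreover have "X ** A ** X = X"
    unfolding XA by (metis X_def inner comm matrix_mul_assoc)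
  ultimately have X: "is_moore_penrose_inverse A X"
    by (simp add: is_moore_penrose_inverse_def AX XA inner)
  have "moore_penrose_inverse A = X"
    unfolding moore_penrose_inverse_def
    by (rule the_equality[where P = "is_moore_penrose_inverse A", OF X])
      (rule moore_penrose_inverse_unique[OF _ X])
  then show ?thesis
    using hermitian_sandwich[OF Q A] by (simp add: X_def)
qed

section \<open>Non-negative Hermitian matrices\<close>

lemma sum_cnj_conj_transpose_vector:
  fixes A :: "complex ^ 'n::finite ^ 'm::finite"
  shows "(\<Sum>i\<in>UNIV. cnj (x $ i) * (conj_transpose A *v y) $ i) = (\<Sum>j\<in>UNIV. cnj ((A *v x) $ j) * y $ j)"
proof -
  have "(\<Sum>i\<in>UNIV. cnj (x $ i) * (conj_transpose A *v y) $ i)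
      = (\<Sum>i\<in>UNIV. \<Sum>j\<in>UNIV. cnj (x $ i) * (cnj (A $ j $ i) * y $ j))"
    by (simp add: matrix_vector_mult_def conj_transpose_def sum_distrib_left)
  also have "\<dots> = (\<Sum>j\<in>UNIV. \<Sum>i\<in>UNIV. cnj (x $ i) * (cnj (A $ j $ i) * y $ j))"
    by (rule sum.swap)
  also have "\<dots> = (\<Sum>j\<in>UNIV. cnj ((A *v x) $ j) * y $ j)"
    by (simp add: matrix_vector_mult_def sum_distrib_left sum_distrib_right mult_ac)
  finally show ?thesis .
qed

text \<open>The form of the conjugated matrix at \<open>x\<close> is the form of \<open>B\<close> at
  \<open>A *v x\<close>.\<close>

lemma nonneg_hermitian_conjugate:
  fixes A :: "complex ^ 'n::finite ^ 'm::finite"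
  assumes "nonneg_hermitian B"
  shows "nonneg_hermitian (conj_transpose A ** B ** A)"
  using assms hermitian_conjugate[of B A]
  by (simp add: nonneg_hermitian_def sum_cnj_conj_transpose_vector
      flip: matrix_vector_mul_assoc)

section \<open>Reciprocal sequences and the S-transform\<close>

lemma hermitian_alpha_shift:
  assumes "\<And>i. i \<le> j \<Longrightarrow> hermitian (s i)"
  shows "hermitian (alpha_shift \<alpha> s j)"
  using assms by (auto simp: alpha_shift_def hermitian_def conj_transpose_simps)

lemma alpha_shift_cong:
  assumes "\<And>i. i \<le> j \<Longrightarrow> s i = t i"
  shows "alpha_shift \<alpha> s j = alpha_shift \<alpha> t j"
  using assms by (simp add: alpha_shift_def)

lemma reciprocal_seq_cong:
  assumes "\<And>i. i \<le> k \<Longrightarrow> u i = v i"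
  shows "reciprocal_seq u k = reciprocal_seq v k"
  using assms
proof (induction k rule: less_induct)
  case (less k)
  show ?case
  proof (cases k)
    case (Suc n)
    have "(\<Sum>l = 0..n. u (Suc n - l) ** reciprocal_seq u l)
        = (\<Sum>l = 0..n. v (Suc n - l) ** reciprocal_seq v l)"
      by (intro sum.cong refl) (use less Suc in simp)
    with less.prems show ?thesis by (simp add: Suc)
  qed (use less.prems in simp)
qed

text \<open>Splits off the summand for index 0, the only one in which \<open>u k\<close>
  occurs.\<close>

lemma reciprocal_seq_pos:
  assumes "k > 0"
  shows "reciprocal_seq u k =
    - (moore_penrose_inverse (u 0) ** u k ** moore_penrose_inverse (u 0))
    - moore_penrose_inverse (u 0) ** (\<Sum>l\<in>{0<..<k}. u (k - l) ** reciprocal_seq u l)"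
proof -
  obtain n where k: "k = Suc n" using assms by (cases k) auto
  have "{0..n} = insert 0 {0<..<k}" using k by auto
  then have "(\<Sum>l = 0..n. u (k - l) ** reciprocal_seq u l)
      = u k ** moore_penrose_inverse (u 0) + (\<Sum>l\<in>{0<..<k}. u (k - l) ** reciprocal_seq u l)"
    by simp
  then show ?thesis
    by (simp add: k matrix_mult_left_simps matrix_mult_right_simps matrix_mul_assoc sum_negf)
qed

lemma hermitian_reciprocal_seq:
  assumes "\<And>i. i \<le> k \<Longrightarrow> hermitian (u i)"
  shows "hermitian (reciprocal_seq u k)"
  using assms
proof (induction k rule: less_induct)
  case (less k)
  define D where "D = moore_penrose_inverse (u 0)"
  define r where "r = reciprocal_seq u"
  have D: "conj_transpose D = D"
    using hermitian_moore_penrose_inverse[of "u 0"] less.prems by (simp add: D_def hermitian_def)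
  have u: "conj_transpose (u i) = u i" if "i \<le> k" for i
    using less.prems that by (simp add: hermitian_def)
  have r: "conj_transpose (r i) = r i" if "i < k" for i
    using less that by (simp add: r_def hermitian_def)
  show ?case
  proof (cases "k = 0")
    case True
    with D show ?thesis by (simp add: D_def hermitian_def)
  next
    case False
    \<comment> \<open>The recursion from the right is the adjoint of the defining one; it needs the
      induction hypothesis for all indices up to \<open>l\<close>.\<close>
    have right: "r l = - ((\<Sum>i<l. r i ** u (l - i)) ** D)" if l: "l \<in> {0<..<k}" for l
    proof -
      obtain n where n: "l = Suc n" using l by (cases l) auto
      have "r l = - (D ** (\<Sum>i<l. u (l - i) ** r i))"
        by (simp add: r_def D_def n lessThan_Suc_atMost atMost_atLeast0 matrix_mult_right_simps)
      then have "conj_transpose (r l)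
          = - ((\<Sum>i<l. conj_transpose (r i) ** conj_transpose (u (l - i))) ** D)"
        by (simp add: conj_transpose_simps conj_transpose_mult D)
      also have "(\<Sum>i<l. conj_transpose (r i) ** conj_transpose (u (l - i)))
          = (\<Sum>i<l. r i ** u (l - i))"
        using l by (intro sum.cong refl arg_cong2[where f = "(**)"] r u) auto
      finally show ?thesis using l r by simp
    qed
    define E where "E = (\<Sum>l\<in>{0<..<k}. \<Sum>i<l. u (k - l) ** r i ** u (l - i))"
    \<comment> \<open>With the middle index \<open>i\<close> outermost, each inner sum is Hermitian
      by itself.\<close>
    have E: "E = (\<Sum>i<k. \<Sum>l\<in>{i<..<k}. u (k - l) ** r i ** u (l - i))"
      unfolding E_def
      by (subst (1 2) sum.Sigma, simp_all,
          rule sum.reindex_bij_witness[where i = "\<lambda>(a, b). (b, a)" and j = "\<lambda>(a, b). (b, a)"]) auto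
    have "conj_transpose (\<Sum>l\<in>{i<..<k}. u (k - l) ** r i ** u (l - i))
        = (\<Sum>l\<in>{i<..<k}. u (k - l) ** r i ** u (l - i))" if "i < k" for i
    proof -
      have "conj_transpose (\<Sum>l\<in>{i<..<k}. u (k - l) ** r i ** u (l - i))
          = (\<Sum>l\<in>{i<..<k}. u (l - i) ** r i ** u (k - l))"
        using that by (simp add: conj_transpose_simps conj_transpose_mult u
            u[OF le_trans[OF diff_le_self]] r matrix_mul_assoc)
      also have "\<dots> = (\<Sum>l\<in>{i<..<k}. u (k - l) ** r i ** u (l - i))"
        \<comment> \<open>The reflection of the interval about its midpoint interchanges
          \<open>k - l\<close> and \<open>l - i\<close>.\<close>
        by (rule sum.reindex_bij_witness[where i = "\<lambda>l. k + i - l" and j = "\<lambda>l. k + i - l"]) auto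
      finally show ?thesis .
    qed
    then have E_herm: "conj_transpose E = E"
      by (simp add: E conj_transpose_simps)
    have "(\<Sum>l\<in>{0<..<k}. u (k - l) ** r l) = - (E ** D)"
      by (simp add: right E_def matrix_mult_left_simps matrix_mult_right_simps matrix_mul_assoc
          sum_negf)
    moreover have "r k = - (D ** u k ** D) - D ** (\<Sum>l\<in>{0<..<k}. u (k - l) ** r l)"
      unfolding r_def D_def using False by (intro reciprocal_seq_pos) simp
    ultimately have "r k = D ** (E - u k) ** D"
      by (simp add: matrix_mult_left_simps matrix_mult_right_simps matrix_mul_assoc)
    then show ?thesis
      by (simp add: r_def hermitian_def conj_transpose_mult conj_transpose_simps D E_herm u
          matrix_mul_assoc)
  qed
qed

lemma hermitian_S_transform:
  assumes "\<And>i. i \<le> Suc j \<Longrightarrow> hermitian (s i)"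
  shows "hermitian (S_transform \<alpha> s j)"
proof -
  have "hermitian (reciprocal_seq (alpha_shift \<alpha> s) (Suc j))"
    using assms by (intro hermitian_reciprocal_seq hermitian_alpha_shift) auto
  then have "hermitian (s 0 ** reciprocal_seq (alpha_shift \<alpha> s) (Suc j) ** s 0)"
    using assms by (intro hermitian_sandwich) auto
  then show ?thesis
    by (simp add: S_transform_def hermitian_def conj_transpose_simps del: reciprocal_seq.simps)
qed

lemma S_transform_cong:
  assumes "\<And>i. i \<le> Suc j \<Longrightarrow> s i = t i"
  shows "S_transform \<alpha> s j = S_transform \<alpha> t j"
proof -
  have "reciprocal_seq (alpha_shift \<alpha> s) (Suc j) = reciprocal_seq (alpha_shift \<alpha> t) (Suc j)"
    using assms by (intro reciprocal_seq_cong alpha_shift_cong) auto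
  with assms show ?thesis by (simp add: S_transform_def del: reciprocal_seq.simps)
qed

text \<open>By \<open>reciprocal_seq_pos\<close>, the reciprocal sequences at \<open>Suc j\<close>
  differ only in the term with the last entry. The minus signs of the reciprocal sequence and of the
  transform cancel, so the order of the difference is kept.\<close>

lemma S_transform_diff:
  assumes "\<And>i. i \<le> j \<Longrightarrow> t i = s i"
  defines "D \<equiv> moore_penrose_inverse (s 0)"
  shows "S_transform \<alpha> s j - S_transform \<alpha> t j = (s 0 ** D) ** (s (Suc j) - t (Suc j)) ** (D ** s 0)"
proof -
  let ?u = "alpha_shift \<alpha> s" and ?v = "alpha_shift \<alpha> t"
  have eq: "?v i = ?u i" if "i \<le> j" for i
    using assms(1) that by (intro alpha_shift_cong) auto
  have D: "moore_penrose_inverse (?u 0) = D" "moore_penrose_inverse (?v 0) = D"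
    using assms(1)[of 0] by (simp_all add: alpha_shift_def D_def)
  have "(\<Sum>l\<in>{0<..<Suc j}. ?v (Suc j - l) ** reciprocal_seq ?v l)
      = (\<Sum>l\<in>{0<..<Suc j}. ?u (Suc j - l) ** reciprocal_seq ?u l)"
    by (intro sum.cong refl arg_cong2[where f = "(**)"] reciprocal_seq_cong eq) auto
  then have "reciprocal_seq ?v (Suc j) - reciprocal_seq ?u (Suc j)
      = D ** ?u (Suc j) ** D - D ** ?v (Suc j) ** D"
    by (simp add: reciprocal_seq_pos D del: reciprocal_seq.simps)
  also have "\<dots> = D ** (?u (Suc j) - ?v (Suc j)) ** D"
    by (simp add: matrix_mult_left_simps matrix_mult_right_simps)
  \<comment> \<open>The shifts by \<alpha> cancel because the entries at \<open>j\<close>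
    agree.\<close>
  also have "?u (Suc j) - ?v (Suc j) = s (Suc j) - t (Suc j)"
    using assms(1) by (simp add: alpha_shift_def)
  finally have diff: "reciprocal_seq ?v (Suc j) - reciprocal_seq ?u (Suc j)
      = D ** (s (Suc j) - t (Suc j)) ** D" .
  have "S_transform \<alpha> s j - S_transform \<alpha> t j
      = s 0 ** (reciprocal_seq ?v (Suc j) - reciprocal_seq ?u (Suc j)) ** s 0"
    using assms(1)[of 0]
    by (simp add: S_transform_def matrix_mult_left_simps matrix_mult_right_simps
        del: reciprocal_seq.simps)
  then show ?thesis by (simp only: diff matrix_mul_assoc)
qed

text \<open>The outer factors in \<open>S_transform_diff\<close> are adjoint to each other, so the
  difference is a conjugate of a non-negative Hermitian matrix.\<close>

lemma S_transform_mono: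
  assumes "\<And>i. i \<le> j \<Longrightarrow> t i = s i" and "hermitian (s 0)" and "loewner_le (t (Suc j)) (s (Suc j))"
  shows "loewner_le (S_transform \<alpha> t j) (S_transform \<alpha> s j)"
proof -
  let ?Z = "moore_penrose_inverse (s 0) ** s 0"
  have "conj_transpose ?Z = s 0 ** moore_penrose_inverse (s 0)"
    using assms(2) hermitian_moore_penrose_inverse[OF assms(2)]
    by (simp add: conj_transpose_mult hermitian_def)
  then show ?thesis
    using nonneg_hermitian_conjugate[of "s (Suc j) - t (Suc j)" ?Z] assms(3)
    by (simp add: loewner_le_def S_transform_diff[OF assms(1)])
qed

theorem lemma3p6:
  fixes \<alpha> :: real
    and m :: nat
    and s t :: "nat \<Rightarrow> complex ^ 'q::finite ^ 'q"
  assumes "m \<ge> 1"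
    and "\<forall>j\<in>{0..m}. hermitian (s j)"
    and "\<forall>j\<in>{0..m}. hermitian (t j)"
    and "\<forall>j\<in>{0..m - 1}. t j = s j"
    and "loewner_le (t m) (s m)"
  shows "(\<forall>j\<in>{0..m - 1}. hermitian (S_transform \<alpha> s j) \<and> hermitian (S_transform \<alpha> t j))
    \<and> (loewner_le (S_transform \<alpha> t (m - 1)) (S_transform \<alpha> s (m - 1))
       \<and> (m \<ge> 2 \<longrightarrow> (\<forall>j\<in>{0..m - 2}. S_transform \<alpha> t j = S_transform \<alpha> s j)))"
proof (intro conjI ballI impI)
  fix j assume "j \<in> {0..m - 1}"
  then show "hermitian (S_transform \<alpha> s j)" "hermitian (S_transform \<alpha> t j)"
    using assms(1-3) by (auto intro!: hermitian_S_transform)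
next
  show "loewner_le (S_transform \<alpha> t (m - 1)) (S_transform \<alpha> s (m - 1))"
    using assms by (intro S_transform_mono) auto
next
  \<comment> \<open>The transform at \<open>j\<close> reads entries up to \<open>j + 1\<close>,
    which is at most \<open>m - 1\<close> since \<open>2 \<le> m\<close> rules out truncation in
    \<open>m - 2\<close>.\<close>
  fix j assume "2 \<le> m" "j \<in> {0..m - 2}"
  then show "S_transform \<alpha> t j = S_transform \<alpha> s j"
    using assms(4) by (intro S_transform_cong) auto
qed

end
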